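(* The map $f\mapsto\operatorname{ord}(f,\cdot)$ defines a group isomorphism from the multiplicative group $\mathrm{TQ}$ of theta quotients onto the additive group $\mathrm{BF}$ of real functions on $\mathbb R$ spanned over $\mathbb Z$ by the functions $x\mapsto B(ax)$ ($a\in\mathbb Z_{>0}$) and the constant function $\frac1{24}$.
   Context: Let $\eta(\tau)=q^{1/24}\prod_{n\ge1}(1-q^n)$, $\vartheta(\tau,z)=\sum_{r\in\mathbb Z}\left(\frac{-4}{r}\right)q^{r^2/8}\zeta^{r/2}$, $q=e^{2\pi i\tau}$, $\zeta=e^{2\pi iz}$, $\vartheta_a(\tau,z)=\vartheta(\tau,az)$. A theta quotient is a function $f=\eta^n\,\vartheta_{a_1}\cdots\vartheta_{a_r}/(\vartheta_{b_1}\cdots\vartheta_{b_s})$ with $n\in\mathbb Z$ and nonzero integers $a_j,b_j$; they form a group $\mathrm{TQ}$ under multiplication. Let $B(x)=\min_{k\in\mathbb Z}\frac12(x-\frac12+k)^2$ (which is the order at infinity of $\vartheta$), and define the order at infinity of such $f$ by $\operatorname{ord}(f,x)=\sum_j B(a_jx)-\sum_j B(b_jx)+\frac{n}{24}$ (for a weakly holomorphic Jacobi form with Fourier coefficients $c(n,r)$ and index $m$ this agrees with $\min\{n+rx+mx^2: c(n,r)\ne0\}$).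
   Formalization: Since ϑ is odd in z, ϑ_{-1}/ϑ_1 = -1 lies in TQ with order 0, so the map is not injective on TQ; what is proved is that it is onto BF with kernel {1,-1}, and is an isomorphism from TQ/{1,-1}, and from the subgroup with all a_j, b_j positive, onto BF. *)

theory Defs
  imports "HOL-Complex_Analysis.Complex_Analysis" "HOL-Algebra.Coset" "HOL-Algebra.Generated_Groups"
begin

section \<open>The functions eta and theta\<close>

definition upper_half :: "complex set" where
  "upper_half = {\<tau>. Im \<tau> > 0}"

text \<open>Fractional powers of \<open>q\<close> and \<open>\<zeta>\<close> are read as
  \<open>q\<^sup>s = exp (2 \<pi> i s \<tau>)\<close> and \<open>\<zeta>\<^sup>s = exp (2 \<pi> i s z)\<close>.\<close>

definition nome_pow :: "complex \<Rightarrow> real \<Rightarrow> complex" where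
  "nome_pow w s = exp (2 * of_real pi * \<i> * of_real s * w)"

definition eta :: "complex \<Rightarrow> complex" where
  "eta \<tau> = nome_pow \<tau> (1 / 24) * (\<Prod>n. 1 - nome_pow \<tau> 1 ^ Suc n)"

text \<open>The Kronecker symbol \<open>(-4 / r)\<close>, i.e. the nontrivial Dirichlet character modulo 4.\<close>

definition kronecker_m4 :: "int \<Rightarrow> int" where
  "kronecker_m4 r = (if r mod 4 = 1 then 1 else if r mod 4 = 3 then - 1 else 0)"

definition theta :: "complex \<Rightarrow> complex \<Rightarrow> complex" where
  "theta \<tau> z = (\<Sum>\<^sub>\<infinity>r\<in>(UNIV :: int set).
     of_int (kronecker_m4 r) * nome_pow \<tau> (of_int r ^ 2 / 8) * nome_pow z (of_int r / 2))"

definition theta_mult :: "int \<Rightarrow> complex \<Rightarrow> complex \<Rightarrow> complex" where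
  "theta_mult a \<tau> z = theta \<tau> (of_int a * z)"


section \<open>The group of theta quotients\<close>

text \<open>A theta quotient is a meromorphic function on \<open>upper_half \<times> \<complex>\<close>. As no \<open>theta_mult a \<tau>\<close> with
  \<open>a \<noteq> 0\<close> vanishes identically for any \<open>\<tau>\<close> in \<open>upper_half\<close>, it is meromorphic in \<open>z\<close> for each such
  \<open>\<tau>\<close>. The pointwise quotient has the value 0 wherever its denominator vanishes, also at removable
  singularities; \<open>remove_sings\<close> turns it into the normal form (analytic continuation into removable
  singularities, value 0 at poles). On normal forms, HOL equality is equality of meromorphic
  functions, and the product must be normalised again.\<close>

definition theta_quotient :: "int \<Rightarrow> int list \<Rightarrow> int list \<Rightarrow> complex \<Rightarrow> complex \<Rightarrow> complex" where
  "theta_quotient n as bs = (\<lambda>\<tau>\<in>upper_half. remove_sings (\<lambda>z.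
     eta \<tau> powi n * (\<Prod>a\<leftarrow>as. theta_mult a \<tau> z) / (\<Prod>b\<leftarrow>bs. theta_mult b \<tau> z)))"

definition TQ :: "(complex \<Rightarrow> complex \<Rightarrow> complex) monoid" where
  "TQ = \<lparr>carrier = {theta_quotient n as bs | n as bs. 0 \<notin> set as \<and> 0 \<notin> set bs},
         mult = (\<lambda>f g. \<lambda>\<tau>\<in>upper_half. remove_sings (\<lambda>z. f \<tau> z * g \<tau> z)),
         one = (\<lambda>\<tau>\<in>upper_half. \<lambda>z. 1)\<rparr>"

text \<open>Since \<open>theta\<close> is odd in \<open>z\<close>, the constant \<open>-1 = theta_mult (-1) / theta_mult 1\<close> lies in \<open>TQ\<close>.\<close>

definition TQ_signs :: "(complex \<Rightarrow> complex \<Rightarrow> complex) set" where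
  "TQ_signs = {(\<lambda>\<tau>\<in>upper_half. \<lambda>z. 1), (\<lambda>\<tau>\<in>upper_half. \<lambda>z. - 1)}"

text \<open>Every element of \<open>TQ\<close> is, up to sign, a theta quotient with positive indices only.\<close>

definition TQ_pos :: "(complex \<Rightarrow> complex \<Rightarrow> complex) set" where
  "TQ_pos = {theta_quotient n as bs | n as bs. (\<forall>a\<in>set as. 0 < a) \<and> (\<forall>b\<in>set bs. 0 < b)}"


section \<open>The order at infinity\<close>

definition B :: "real \<Rightarrow> real" where
  "B x = (LEAST y. \<exists>k::int. y = 1 / 2 * (x - 1 / 2 + of_int k) ^ 2)"

definition formal_ord :: "int \<Rightarrow> int list \<Rightarrow> int list \<Rightarrow> real \<Rightarrow> real" where
  "formal_ord n as bs = (\<lambda>x. (\<Sum>a\<leftarrow>as. B (of_int a * x)) - (\<Sum>b\<leftarrow>bs. B (of_int b * x)) + of_int n / 24)"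

text \<open>The order of a theta quotient as a function is read off from any of its presentations; that
  the result does not depend on the presentation has to be proved.\<close>

definition ord_infinity :: "(complex \<Rightarrow> complex \<Rightarrow> complex) \<Rightarrow> real \<Rightarrow> real" where
  "ord_infinity f = (THE g. \<exists>n as bs. 0 \<notin> set as \<and> 0 \<notin> set bs \<and>
     f = theta_quotient n as bs \<and> g = formal_ord n as bs)"

definition real_functions :: "(real \<Rightarrow> real) monoid" where
  "real_functions = \<lparr>carrier = UNIV, mult = (\<lambda>f g x. f x + g x), one = (\<lambda>x. 0)\<rparr>"

text \<open>The \<open>\<int>\<close>-span of a set is the subgroup of the additive group generated by it.\<close>

definition BF :: "(real \<Rightarrow> real) monoid" where
  "BF = real_functions\<lparr>carrier := generate real_functions
     ({(\<lambda>x. B (of_int a * x)) | a :: int. a > 0} \<union> {(\<lambda>x. 1 / 24)})\<rparr>"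

end

theory Submission
  imports Defs "HOL-Library.Multiset"
begin

text \<open>Both \<open>TQ\<close> modulo signs and \<open>BF\<close> are free abelian on the positive indices together with one
  further generator, and \<open>ord\<close> matches the generators. On the side of \<open>BF\<close>, independence follows
  from the kinks: \<open>x \<mapsto> B (b x)\<close> has a jump of its derivative at \<open>1 / A\<close> iff \<open>A\<close> divides \<open>b\<close>, so the
  largest index in a relation must be absent. On the side of \<open>TQ\<close>, \<open>theta \<tau> (A z)\<close> vanishes at
  \<open>z = 1 / A\<close>, whereas \<open>theta \<tau> (b / A)\<close> for \<open>0 < b < A\<close> does not if the imaginary part of \<open>\<tau>\<close> is
  large, because the first term of the sine series dominates; so again the largest index must be
  absent, and \<open>\<bar>eta \<tau>\<bar> < 1\<close> excludes a nontrivial power of \<open>eta\<close>.\<close>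

section \<open>Analytic properties of eta and theta\<close>

lemma kronecker_m4_minus: "kronecker_m4 (- r) = - kronecker_m4 r"
  unfolding kronecker_m4_def zmod_zminus1_eq_if
  using pos_mod_bound[of 4 r] pos_mod_sign[of 4 r] by auto

lemma abs_kronecker_m4_le: "\<bar>kronecker_m4 r\<bar> \<le> 1"
  unfolding kronecker_m4_def by auto

lemma norm_nome_pow: "norm (nome_pow w s) = exp (- 2 * pi * s * Im w)"
  unfolding nome_pow_def by (simp add: norm_exp_eq_Re)

lemma nome_pow_nonzero [simp]: "nome_pow w s \<noteq> 0"
  unfolding nome_pow_def by simp

lemma eta_factor_nonzero:
  assumes "\<tau> \<in> upper_half"
  shows "1 - nome_pow \<tau> 1 ^ Suc n \<noteq> 0"
proof -
  have "norm (nome_pow \<tau> 1) < 1"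
    using assms by (simp add: norm_nome_pow upper_half_def)
  then have "norm (nome_pow \<tau> 1 ^ Suc n) < 1"
    unfolding norm_power by (intro power_Suc_less_one) auto
  then show ?thesis
    by auto
qed

lemma convergent_prod_eta:
  assumes "\<tau> \<in> upper_half"
  shows "convergent_prod (\<lambda>n. 1 - nome_pow \<tau> 1 ^ Suc n)"
proof -
  have q: "norm (nome_pow \<tau> 1) < 1"
    using assms by (simp add: norm_nome_pow upper_half_def)
  have "summable (\<lambda>n. norm (nome_pow \<tau> 1) ^ Suc n)"
    using q by (subst summable_Suc_iff) (simp add: summable_geometric)
  then have "summable (\<lambda>n. norm (1 - nome_pow \<tau> 1 ^ Suc n - 1))"
    by (simp add: norm_power norm_mult)
  then show ?thesis
    by (intro abs_convergent_prod_imp_convergent_prod summable_imp_abs_convergent_prod)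
qed

lemma eta_nonzero:
  assumes "\<tau> \<in> upper_half"
  shows "eta \<tau> \<noteq> 0"
  unfolding eta_def
  using prodinf_nonzero[OF convergent_prod_eta[OF assms] eta_factor_nonzero[OF assms]] by simp

section \<open>Theta as a difference of two values of an entire function\<close>

definition theta_coeff :: "complex \<Rightarrow> nat \<Rightarrow> complex" where
  "theta_coeff \<tau> n = of_int (kronecker_m4 (int n)) * nome_pow \<tau> (real n ^ 2 / 8)"

text \<open>The part of the theta series with r \<ge> 0, with a free variable in place of
  zeta^(1/2). Being a power series in that variable, it opens the way to holomorphy and to
  Liouville's theorem.\<close>

definition theta_half :: "complex \<Rightarrow> complex \<Rightarrow> complex" where
  "theta_half \<tau> w = (\<Sum>n. theta_coeff \<tau> n * w ^ n)"

lemma theta_coeff_0 [simp]: "theta_coeff \<tau> 0 = 0"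
  by (simp add: theta_coeff_def kronecker_m4_def)

lemma norm_theta_coeff_le: "norm (theta_coeff \<tau> n) \<le> exp (- pi * Im \<tau> / 4) ^ n\<^sup>2"
proof -
  have "norm (theta_coeff \<tau> n) \<le> 1 * norm (nome_pow \<tau> (real n ^ 2 / 8))"
    unfolding theta_coeff_def norm_mult using abs_kronecker_m4_le[of "int n"]
    by (intro mult_right_mono) (auto simp flip: of_int_abs)
  also have "\<dots> = exp (- pi * Im \<tau> / 4) ^ n\<^sup>2"
    unfolding norm_nome_pow exp_of_nat_mult[symmetric] by simp
  finally show ?thesis .
qed

text \<open>The coefficients are bounded by x^(n^2) with x < 1, and x^(n^2) |w|^n = (x^n |w|)^n,
  where x^n |w| tends to 0. Hence the series is eventually dominated by a geometric one for every
  \<open>w\<close>.\<close>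

lemma summable_theta_half:
  assumes "\<tau> \<in> upper_half"
  shows "summable (\<lambda>n. norm (theta_coeff \<tau> n * w ^ n))"
proof (rule summable_comparison_test_ev)
  define x where "x = exp (- pi * Im \<tau> / 4)"
  have x: "0 < x" "x < 1"
    using assms by (auto simp: x_def upper_half_def)
  have "(\<lambda>n. x ^ n * norm w) \<longlonglongrightarrow> 0 * norm w"
    using x by (intro tendsto_mult tendsto_const LIMSEQ_power_zero) auto
  then have "\<forall>\<^sub>F n in sequentially. x ^ n * norm w < 1 / 2"
    by (rule order_tendstoD) simp
  then show "\<forall>\<^sub>F n in sequentially. norm (norm (theta_coeff \<tau> n * w ^ n)) \<le> (1 / 2) ^ n"
  proof eventually_elim
    case (elim n)
    have "norm (theta_coeff \<tau> n * w ^ n) \<le> x ^ n\<^sup>2 * norm w ^ n"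
      unfolding norm_mult norm_power x_def
      by (intro mult_right_mono norm_theta_coeff_le) auto
    also have "\<dots> = (x ^ n * norm w) ^ n"
      by (simp add: power_mult_distrib power2_eq_square power_mult)
    also have "\<dots> \<le> (1 / 2) ^ n"
      using elim x by (intro power_mono) auto
    finally show ?case
      by simp
  qed
qed simp

lemma theta_half_sums:
  assumes "\<tau> \<in> upper_half"
  shows "(\<lambda>n. theta_coeff \<tau> n * w ^ n) sums theta_half \<tau> w"
  unfolding theta_half_def
  by (rule summable_sums[OF summable_norm_cancel[OF summable_theta_half[OF assms]]])

lemma theta_half_0 [simp]: "theta_half \<tau> 0 = 0"
  unfolding theta_half_def by (subst powser_zero) simp

lemma theta_half_holomorphic:
  assumes "\<tau> \<in> upper_half"
  shows "theta_half \<tau> holomorphic_on UNIV"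
proof -
  have "summable (\<lambda>n. theta_coeff \<tau> n * w ^ n)" for w
    using summable_theta_half[OF assms] by (rule summable_norm_cancel)
  from termdiffs_strong_converges_everywhere[OF this] show ?thesis
    unfolding theta_half_def[abs_def] holomorphic_on_open[OF open_UNIV] by blast
qed

text \<open>The symbol is odd while r^2 is even, so the terms of negative index form minus the same
  series at the inverse argument.\<close>

lemma theta_eq_theta_half:
  assumes "\<tau> \<in> upper_half"
  shows "theta \<tau> z = theta_half \<tau> (exp (\<i> * pi * z)) - theta_half \<tau> (exp (- \<i> * pi * z))"
proof -
  define t where "t r = of_int (kronecker_m4 r) * nome_pow \<tau> (of_int r ^ 2 / 8)
    * nome_pow z (of_int r / 2)" for r :: int
  have pos: "t (int n) = theta_coeff \<tau> n * exp (\<i> * pi * z) ^ n" for n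
    unfolding t_def theta_coeff_def nome_pow_def exp_of_nat_mult[symmetric]
    by (simp add: algebra_simps)
  have neg: "t (- int n) = - (theta_coeff \<tau> n * exp (- \<i> * pi * z) ^ n)" for n
    unfolding t_def theta_coeff_def nome_pow_def exp_of_nat_mult[symmetric] kronecker_m4_minus
    by (simp add: algebra_simps)
  have "((\<lambda>n. t (int n)) has_sum theta_half \<tau> (exp (\<i> * pi * z))) UNIV"
    unfolding pos using assms
    by (intro norm_summable_imp_has_sum summable_theta_half theta_half_sums)
  then have 1: "(t has_sum theta_half \<tau> (exp (\<i> * pi * z))) (range int)"
    by (subst has_sum_reindex) (auto simp: o_def)
  have "((\<lambda>n. t (- int n)) has_sum - theta_half \<tau> (exp (- \<i> * pi * z))) UNIV"
    unfolding neg using assms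
    by (intro has_sum_uminusI norm_summable_imp_has_sum summable_theta_half theta_half_sums)
  \<comment> \<open>The index 0 carries a zero term; dropping it makes the two index ranges
    disjoint.\<close>
  also have "?this \<longleftrightarrow> ((\<lambda>n. t (- int n)) has_sum - theta_half \<tau> (exp (- \<i> * pi * z))) {0<..}"
    by (rule has_sum_cong_neutral) (auto simp: t_def kronecker_m4_def)
  finally have 2: "(t has_sum - theta_half \<tau> (exp (- \<i> * pi * z))) ((\<lambda>n. - int n) ` {0<..})"
    by (subst has_sum_reindex) (auto simp: o_def inj_on_def)
  have "r \<in> range int \<union> (\<lambda>n. - int n) ` {0<..}" for r
  proof (cases "r \<ge> 0")
    case True
    then show ?thesis
      by (auto intro: range_eqI[of _ _ "nat r"])
  next
    case False
    then show ?thesis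
      by (auto intro!: image_eqI[of _ _ "nat (- r)"])
  qed
  then have U: "range int \<union> (\<lambda>n. - int n) ` {0<..} = UNIV"
    by blast
  have "(t has_sum theta_half \<tau> (exp (\<i> * pi * z)) + - theta_half \<tau> (exp (- \<i> * pi * z))) UNIV"
    unfolding U[symmetric] by (rule has_sum_Un_disjoint[OF 1 2]) auto
  then show ?thesis
    unfolding theta_def t_def by (simp add: infsumI)
qed

lemma theta_holomorphic [holomorphic_intros]:
  assumes "\<tau> \<in> upper_half" "f holomorphic_on S"
  shows "(\<lambda>z. theta \<tau> (f z)) holomorphic_on S"
proof -
  have h: "(\<lambda>z. theta_half \<tau> (g z)) holomorphic_on S" if "g holomorphic_on S" for g
    using holomorphic_on_compose_gen[OF that theta_half_holomorphic[OF assms(1)]]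
    by (simp add: o_def)
  show ?thesis
    unfolding theta_eq_theta_half[OF assms(1)] by (intro holomorphic_intros h assms)
qed

lemma theta_minus:
  assumes "\<tau> \<in> upper_half"
  shows "theta \<tau> (- z) = - theta \<tau> z"
  unfolding theta_eq_theta_half[OF assms] by simp

text \<open>The two half series cancel because exp (i pi) = exp (- i pi). Rescaled to z = 1 / A,
  this is the zero that singles out the index A.\<close>

lemma theta_1:
  assumes "\<tau> \<in> upper_half"
  shows "theta \<tau> 1 = 0"
  unfolding theta_eq_theta_half[OF assms] by (simp add: exp_minus)

text \<open>If \<open>theta \<tau>\<close> vanished identically, \<open>theta_half \<tau>\<close> would be an entire function invariant under
  \<open>w \<mapsto> 1 / w\<close>, hence constant by Liouville, although its linear coefficient is nonzero.\<close>

lemma theta_not_identically_zero: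
  assumes "\<tau> \<in> upper_half"
  shows "\<exists>z. theta \<tau> z \<noteq> 0"
proof (rule ccontr)
  assume "\<nexists>z. theta \<tau> z \<noteq> 0"
  then have *: "theta_half \<tau> (exp (\<i> * pi * z)) = theta_half \<tau> (exp (- (\<i> * pi * z)))" for z
    using theta_eq_theta_half[OF assms, of z] by auto
  have inv: "theta_half \<tau> w = theta_half \<tau> (inverse w)" if "w \<noteq> 0" for w
    using *[of "Ln w / (\<i> * pi)"] that by (simp add: exp_minus)
  have "theta_half \<tau> \<midarrow>0\<rightarrow> theta_half \<tau> 0"
    using theta_half_holomorphic[OF assms]
    by (metis DERIV_isCont UNIV_I field_differentiable_def holomorphic_on_open isContD open_UNIV)
  \<comment> \<open>Invariance under inversion will carry the value 0 at the origin to infinity, so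
    the constant in Liouville's theorem is 0.\<close>
  then have "((\<lambda>w. theta_half \<tau> (inverse w)) \<longlongrightarrow> 0) at_infinity"
    by (simp add: lim_at_infinity_0 o_def)
  moreover have "\<forall>\<^sub>F w in at_infinity. w \<noteq> (0::complex)"
    by (metis eventually_not_equal_at_infinity)
  then have "\<forall>\<^sub>F w in at_infinity. theta_half \<tau> (inverse w) = theta_half \<tau> w"
    by eventually_elim (simp flip: inv)
  ultimately have "(theta_half \<tau> \<longlongrightarrow> 0) at_infinity"
    by (simp add: tendsto_cong)
  then have zero: "theta_half \<tau> w = 0" for w
    using Liouville_weak_0 theta_half_holomorphic[OF assms] by blast
  have "theta_coeff \<tau> 1 \<noteq> 0"
    by (simp add: theta_coeff_def kronecker_m4_def)
  then obtain s where "s > 0" "\<And>w. w \<in> cball 0 s - {0} \<Longrightarrow> theta_half \<tau> w \<noteq> 0"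
    using powser_0_nonzero[of 1 0 "theta_coeff \<tau>" "theta_half \<tau>" 1] theta_half_sums[OF assms]
    by auto
  from this(1) this(2)[of "of_real s"] show False
    by (simp add: zero)
qed

text \<open>Zeros of an entire function that is not identically zero are isolated, and rescaling by
  \<open>a \<noteq> 0\<close> does not make \<open>theta\<close> vanish identically.\<close>

lemma eventually_theta_nonzero:
  assumes "\<tau> \<in> upper_half" "a \<noteq> 0"
  shows "\<forall>\<^sub>F z in at x. theta_mult a \<tau> z \<noteq> 0"
proof -
  obtain z where z: "theta \<tau> z \<noteq> 0"
    using theta_not_identically_zero[OF assms(1)] by blast
  have "theta_mult a \<tau> holomorphic_on UNIV"
    unfolding theta_mult_def[abs_def] by (intro holomorphic_intros assms)
  moreover have "theta_mult a \<tau> (z / of_int a) \<noteq> 0"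
    using z assms(2) by (simp add: theta_mult_def)
  ultimately have "\<forall>\<^sub>F z in at x. theta_mult a \<tau> z \<noteq> 0 \<and> z \<in> UNIV"
    by (intro non_zero_neighbour_alt[where \<beta> = "z / of_int a"]) auto
  then show ?thesis
    by simp
qed

section \<open>Estimates at a single point of the upper half-plane\<close>

text \<open>At this \<open>\<tau>\<close> the sine series of \<open>theta\<close> has coefficients of modulus at most \<open>(1 / 4) ^ n\<^sup>2\<close>,
  so that its first term dominates the others on the real axis.\<close>

definition tau0 :: complex where
  "tau0 = \<i> * of_real (4 * ln 4 / pi)"

lemma tau0_upper_half: "tau0 \<in> upper_half"
  by (simp add: tau0_def upper_half_def)

text \<open>Bounds every harmonic by a multiple of the first one. The common factor |sin x| makes
  the comparison of tail and first term uniform, even near the zeros of the sine.\<close>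

lemma abs_sin_multiple_le: "\<bar>sin (real n * x)\<bar> \<le> real n * \<bar>sin x\<bar>"
proof (induction n)
  case (Suc n)
  have "\<bar>sin (real (Suc n) * x)\<bar> = \<bar>sin (real n * x) * cos x + cos (real n * x) * sin x\<bar>"
    by (simp add: sin_add algebra_simps)
  also have "\<dots> \<le> \<bar>sin (real n * x)\<bar> * \<bar>cos x\<bar> + \<bar>cos (real n * x)\<bar> * \<bar>sin x\<bar>"
    by (metis abs_mult abs_triangle_ineq)
  also have "\<dots> \<le> \<bar>sin (real n * x)\<bar> * 1 + 1 * \<bar>sin x\<bar>"
    by (intro add_mono mult_left_mono mult_right_mono) auto
  finally show ?case
    using Suc by (simp add: algebra_simps)
qed simp

lemma norm_theta_coeff_tau0_le: "norm (theta_coeff tau0 n) \<le> (1 / 4) ^ n\<^sup>2"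
proof -
  have "exp (- pi * Im tau0 / 4) = exp (- ln 4)"
    by (simp add: tau0_def)
  also have "\<dots> = 1 / 4"
    by (subst exp_minus) simp
  finally show ?thesis
    using norm_theta_coeff_le[of tau0 n] by (simp only:)
qed

text \<open>At a zero the first term, of modulus sin (pi s) / 2, would be minus the tail, but the
  tail has modulus at most (8/7) sin (pi s) / 32 = sin (pi s) / 28.\<close>

lemma theta_tau0_nonzero:
  assumes "0 < s" "s < 1"
  shows "theta tau0 (of_real s) \<noteq> 0"
proof
  assume zero: "theta tau0 (of_real s) = 0"
  have pos: "sin (pi * s) > 0"
    using assms by (intro sin_gt_zero) auto
  define f where "f n = theta_coeff tau0 n * (2 * \<i> * of_real (sin (real n * (pi * s))))" for n
  have "theta_coeff tau0 n * exp (\<i> * pi * of_real s) ^ n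
      - theta_coeff tau0 n * exp (- \<i> * pi * of_real s) ^ n = f n" for n
  proof -
    have "exp (\<i> * pi * of_real s) ^ n - exp (- \<i> * pi * of_real s) ^ n
        = cis (real n * (pi * s)) - cis (- (real n * (pi * s)))"
      unfolding exp_of_nat_mult[symmetric] cis_conv_exp by (simp add: algebra_simps)
    also have "\<dots> = 2 * \<i> * of_real (sin (real n * (pi * s)))"
      by (simp add: complex_eq_iff)
    finally show ?thesis
      by (simp only: f_def flip: right_diff_distrib)
  qed
  then have "f sums 0"
    using sums_diff[OF theta_half_sums[OF tau0_upper_half] theta_half_sums[OF tau0_upper_half],
        of "exp (\<i> * pi * of_real s)" "exp (- \<i> * pi * of_real s)"]
      zero theta_eq_theta_half[OF tau0_upper_half, of "of_real s"] by simp
  \<comment> \<open>The terms of index 0 and 1 are split off; the former is 0.\<close>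
  then have "(\<lambda>n. f (n + 2)) sums (0 - (\<Sum>i<2. f i))"
    by (rule sums_split_initial_segment)
  then have tail: "(\<lambda>n. f (n + 2)) sums - f 1"
    by (simp add: numeral_2_eq_2 f_def)
  have "(\<lambda>n. (1 / 8) ^ n) sums (1 / (1 - 1 / 8 :: real))"
    by (rule geometric_sums) simp
  then have geo: "(\<lambda>n. (1 / 8) ^ n * (sin (pi * s) / 32)) sums (1 / (1 - 1 / 8) * (sin (pi * s) / 32))"
    by (rule sums_mult2)
  \<comment> \<open>For m = n + 2, the estimates m^2 \<ge> 2m and m \<le> 2^m leave 2 (1/8)^m sin
    (pi s); the shift by 2 turns the factor 2 into 2/64 = 1/32.\<close>
  have bound: "norm (f (n + 2)) \<le> (1 / 8) ^ n * (sin (pi * s) / 32)" for n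
  proof -
    let ?m = "n + 2"
    have "norm (f ?m) = norm (theta_coeff tau0 ?m) * (2 * \<bar>sin (real ?m * (pi * s))\<bar>)"
      by (simp add: f_def norm_mult)
    also have "\<dots> \<le> (1 / 4) ^ ?m\<^sup>2 * (2 * (real ?m * \<bar>sin (pi * s)\<bar>))"
      by (intro mult_mono norm_theta_coeff_tau0_le abs_sin_multiple_le order_refl) auto
    also have "\<dots> \<le> (1 / 4) ^ (2 * ?m) * (2 * (2 ^ ?m * \<bar>sin (pi * s)\<bar>))"
    proof (intro mult_mono order_refl power_decreasing)
      show "2 * ?m \<le> ?m\<^sup>2"
        by (simp add: power2_eq_square)
      show "real ?m \<le> 2 ^ ?m"
        using of_nat_mono[OF less_imp_le[OF less_exp[of ?m]], where ?'a = real] by simp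
    qed auto
    also have "\<dots> = (1 / 16) ^ ?m * 2 ^ ?m * 2 * sin (pi * s)"
      using pos by (simp add: power_mult power2_eq_square)
    also have "(1 / 16 :: real) ^ ?m * 2 ^ ?m = (1 / 8) ^ ?m"
      by (simp flip: power_mult_distrib)
    finally show ?thesis
      by (simp add: power_add)
  qed
  have "norm (- f 1) \<le> 1 / (1 - 1 / 8) * (sin (pi * s) / 32)"
    using norm_sums_le[OF tail geo bound] .
  moreover have "norm (f 1) = sin (pi * s) / 2"
  proof -
    have "norm (theta_coeff tau0 1) = exp (- ln 4)"
      by (simp add: theta_coeff_def kronecker_m4_def norm_mult norm_nome_pow tau0_def)
    also have "\<dots> = 1 / 4"
      by (subst exp_minus) simp
    finally show ?thesis
      using pos by (simp add: f_def norm_mult)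
  qed
  ultimately show False
    using pos by simp
qed

text \<open>As \<open>tau0\<close> is purely imaginary, q lies in the real interval (0, 1). Every
  factor of the product then has modulus at most 1, and the prefactor q^(1/24) makes the inequality
  strict.\<close>

lemma norm_eta_tau0_less_1: "norm (eta tau0) < 1"
proof -
  \<comment> \<open>2 pi Im \<open>tau0\<close> = 8 ln 4, so r is the value of q at
    \<open>tau0\<close>.\<close>
  define r where "r = exp (- 8 * ln 4 :: real)"
  have r: "0 < r" "r < 1"
    by (auto simp: r_def)
  have q: "nome_pow tau0 1 = of_real r"
    by (simp add: nome_pow_def tau0_def r_def exp_of_real[symmetric])
  have le: "norm (1 - nome_pow tau0 1 ^ Suc n) \<le> 1" for n
  proof -
    have "0 \<le> r ^ Suc n" "r ^ Suc n \<le> 1"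
      using r by (auto simp del: power_Suc intro: power_le_one)
    moreover have "1 - nome_pow tau0 1 ^ Suc n = of_real (1 - r ^ Suc n)"
      by (simp add: q)
    ultimately show ?thesis
      by (simp only: norm_of_real)
  qed
  have "norm (\<Prod>i\<le>n. 1 - nome_pow tau0 1 ^ Suc i) \<le> 1" for n
    unfolding prod_norm[symmetric] by (intro prod_le_1) (use le in auto)
  moreover have "(\<lambda>n. norm (\<Prod>i\<le>n. 1 - nome_pow tau0 1 ^ Suc i))
      \<longlonglongrightarrow> norm (\<Prod>n. 1 - nome_pow tau0 1 ^ Suc n)"
    by (intro tendsto_norm convergent_prod_LIMSEQ convergent_prod_eta tau0_upper_half)
  ultimately have "norm (\<Prod>n. 1 - nome_pow tau0 1 ^ Suc n) \<le> 1"
    by (intro LIMSEQ_le_const2) auto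
  moreover have "norm (nome_pow tau0 (1 / 24)) < 1"
    by (simp add: norm_nome_pow tau0_def)
  ultimately have "norm (nome_pow tau0 (1 / 24)) * norm (\<Prod>n. 1 - nome_pow tau0 1 ^ Suc n) < 1 * 1"
    by (intro mult_less_le_imp_less) (use prodinf_nonzero[OF convergent_prod_eta eta_factor_nonzero]
        tau0_upper_half in auto)
  then show ?thesis
    by (simp add: eta_def norm_mult)
qed

lemma eta_tau0_powi_eq:
  assumes "norm (eta tau0 powi n) = 1"
  shows "n = 0"
proof (rule ccontr)
  assume "n \<noteq> 0"
  define x where "x = norm (eta tau0)"
  have x: "0 < x" "x < 1"
    using norm_eta_tau0_less_1 eta_nonzero[OF tau0_upper_half] by (auto simp: x_def)
  have less: "x ^ k < 1" if "k > 0" for k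
    using x that by (simp add: power_less_one_iff)
  have "x powi n \<noteq> 1"
  proof (cases "n > 0")
    case True
    then show ?thesis
      using less[of "nat n"] by (simp add: power_int_def)
  next
    case False
    then show ?thesis
      using less[of "nat (- n)"] \<open>n \<noteq> 0\<close> by (simp add: power_int_def field_simps)
  qed
  then show False
    using assms by (simp add: x_def norm_power_int)
qed

section \<open>Independence of the functions B (a x)\<close>

text \<open>The combinatorial core shared by both independence arguments. If the multisets differ,
  the largest element of the two differences lies in only one of them, hence strictly exceeds every
  element of the other; each hypothesis excludes one of the two cases.\<close>

lemma multiset_eq_by_max_difference:
  fixes M N :: "'a::linorder multiset"
  assumes MN: "\<And>m. m \<in># M - N \<Longrightarrow> (\<forall>a\<in>#M - N. a \<le> m) \<Longrightarrow> (\<forall>b\<in>#N - M. b < m) \<Longrightarrow> False"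
    and NM: "\<And>m. m \<in># N - M \<Longrightarrow> (\<forall>a\<in>#N - M. a \<le> m) \<Longrightarrow> (\<forall>b\<in>#M - N. b < m) \<Longrightarrow> False"
  shows "M = N"
proof (rule ccontr)
  assume "M \<noteq> N"
  define S where "S = set_mset (M - N) \<union> set_mset (N - M)"
  have disj: "a \<notin># N - M" if "a \<in># M - N" for a
    using that by (simp add: in_diff_count)
  have "S \<noteq> {}"
    using \<open>M \<noteq> N\<close> by (auto simp: S_def Diff_eq_empty_iff_mset subset_mset.antisym)
  moreover have "finite S"
    by (simp add: S_def)
  ultimately have "Max S \<in> S" and le: "\<And>a. a \<in> S \<Longrightarrow> a \<le> Max S"
    by auto
  then consider "Max S \<in># M - N" | "Max S \<in># N - M"
    unfolding S_def by blast
  then show False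
  proof cases
    case 1
    then have "b \<noteq> Max S" if "b \<in># N - M" for b
      using disj that by metis
    then show False
      by (intro MN[OF 1]) (use le in \<open>auto simp: S_def order.strict_iff_order simp del: in_diff_count\<close>)
  next
    case 2
    then have "b \<noteq> Max S" if "b \<in># M - N" for b
      using disj that by metis
    then show False
      by (intro NM[OF 2]) (use le in \<open>auto simp: S_def order.strict_iff_order\<close>)
  qed
qed

lemma multiset_inter_plus_diff: "M \<inter># N + (M - N) = M"
  by (intro multiset_eqI) simp

text \<open>The minimum is attained at the shift bringing x - 1/2 into the interval [-1/2,
  1/2).\<close>

lemma B_eq_frac: "B x = 1 / 2 * (frac x - 1 / 2) ^ 2"
  unfolding B_def
proof (rule Least_equality)
  show "\<exists>k::int. 1 / 2 * (frac x - 1 / 2) ^ 2 = 1 / 2 * (x - 1 / 2 + of_int k) ^ 2"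
    by (intro exI[of _ "- \<lfloor>x\<rfloor>"]) (simp add: frac_def algebra_simps)
next
  fix y :: real
  assume "\<exists>k::int. y = 1 / 2 * (x - 1 / 2 + of_int k) ^ 2"
  then obtain k :: int where k: "y = 1 / 2 * (x - 1 / 2 + of_int k) ^ 2"
    by blast
  define j where "j = k + \<lfloor>x\<rfloor>"
  define u where "u = frac x"
  have u: "0 \<le> u" "u < 1"
    by (auto simp: u_def frac_lt_1)
  have x: "x - 1 / 2 + of_int k = u - 1 / 2 + of_int j"
    by (simp add: u_def frac_def j_def)
  \<comment> \<open>This is twice the increase of (u - 1/2)^2 / 2 under a shift by j. It is
    nonnegative because |2u - 1| \<le> 1 \<le> |j| unless j = 0.\<close>
  have "of_int j * (2 * u - 1 + of_int j) \<ge> 0"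
  proof -
    consider "j \<le> - 1" | "j = 0" | "j \<ge> 1"
      by linarith
    then show ?thesis
    proof cases
      case 1
      then have "real_of_int j \<le> - 1"
        by linarith
      then show ?thesis
        using u by (intro mult_nonpos_nonpos) auto
    next
      case 3
      then have "real_of_int j \<ge> 1"
        by linarith
      then show ?thesis
        using u by (intro mult_nonneg_nonneg) auto
    qed simp
  qed
  then show "1 / 2 * (frac x - 1 / 2) ^ 2 \<le> y"
    unfolding k x u_def[symmetric] by (simp add: power2_eq_square algebra_simps)
qed

lemma B_minus: "B (- x) = B x"
  by (simp add: B_eq_frac frac_neg power2_eq_square algebra_simps)
    (auto simp: frac_eq_0_iff field_simps)

text \<open>\<open>B\<close> is piecewise quadratic, with a jump of its derivative exactly at the integers. The
  symmetric second difference detects this jump.\<close>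

lemma B_kink:
  fixes b x :: real
  assumes "b > 0"
  shows "((\<lambda>h. (B (b * (x + h)) + B (b * (x - h)) - 2 * B (b * x)) / h)
    \<longlongrightarrow> (if b * x \<in> \<int> then - b else 0)) (at_right 0)"
proof -
  define u where "u = frac (b * x)"
  \<comment> \<open>For h < e neither b (x + h) nor b (x - h) crosses an integer other than b x
    itself, so both fractional parts are explicit.\<close>
  define e where "e = (if b * x \<in> \<int> then 1 else min u (1 - u)) / b"
  have u: "0 \<le> u" "u < 1"
    by (auto simp: u_def frac_lt_1)
  have u0: "u = 0 \<longleftrightarrow> b * x \<in> \<int>"
    by (simp add: u_def frac_eq_0_iff)
  have int: "b * x - u \<in> \<int>"
    by (simp add: u_def frac_def)
  have "e > 0"
    using assms u u0 by (auto simp: e_def)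
  then have "\<forall>\<^sub>F h in at_right 0. h \<in> {0<..<e}"
    by (intro eventually_at_right_real)
  \<comment> \<open>Near 0 the second difference is exactly b^2 h^2, with the extra term - b h when
    b x is an integer.\<close>
  then have "\<forall>\<^sub>F h in at_right 0. b\<^sup>2 * h - (if b * x \<in> \<int> then b else 0)
      = (B (b * (x + h)) + B (b * (x - h)) - 2 * B (b * x)) / h"
  proof eventually_elim
    case (elim h)
    then have h: "0 < h" "b * h < (if b * x \<in> \<int> then 1 else min u (1 - u))"
      using assms by (auto simp: e_def field_simps)
    have bh: "0 < b * h"
      using h assms by simp
    have "frac (b * (x + h)) = u + b * h"
      unfolding frac_unique_iff using int h u u0 bh
      by (auto simp: algebra_simps split: if_splits)
    moreover have "frac (b * (x - h)) = (if b * x \<in> \<int> then 1 - b * h else u - b * h)"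
    proof (cases "b * x \<in> \<int>")
      case True
      have "b * (x - h) - (1 - b * h) = b * x - 1"
        by (simp add: algebra_simps)
      also have "\<dots> \<in> \<int>"
        using True by simp
      finally show ?thesis
        unfolding frac_unique_iff using True h bh by auto
    next
      case False
      have "b * (x - h) - (u - b * h) = b * x - u"
        by (simp add: algebra_simps)
      also note int
      finally show ?thesis
        unfolding frac_unique_iff using False h bh u by (auto simp: min_def split: if_splits)
    qed
    ultimately show ?case
      using u0 h(1) unfolding B_eq_frac u_def[symmetric]
      by (auto simp: field_simps power2_eq_square)
  qed
  moreover have "((\<lambda>h. b\<^sup>2 * h - (if b * x \<in> \<int> then b else 0))
      \<longlongrightarrow> b\<^sup>2 * 0 - (if b * x \<in> \<int> then b else 0)) (at_right 0)"
    by (intro tendsto_intros)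
  ultimately show ?thesis
    using Lim_transform_eventually by fastforce
qed

text \<open>Kinks are additive, and b / A is an integer exactly when A divides b, so only multiples
  of A contribute at 1 / A, each with its own value as weight.\<close>

lemma sum_B_kink:
  fixes M :: "int multiset" and A :: int
  assumes "\<forall>b\<in>#M. 0 < b" "A > 0"
  defines "F \<equiv> \<lambda>x::real. \<Sum>b\<in>#M. B (of_int b * x)"
  shows "((\<lambda>h. (F (1 / of_int A + h) + F (1 / of_int A - h) - 2 * F (1 / of_int A)) / h)
    \<longlongrightarrow> - of_int (\<Sum>b\<in>#M. if A dvd b then b else 0)) (at_right 0)"
  using assms(1) unfolding F_def
proof (induction M)
  case (add b M)
  have "of_int b * (1 / of_int A) \<in> (\<int> :: real set) \<longleftrightarrow> A dvd b"
  proof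
    assume "of_int b * (1 / of_int A) \<in> (\<int> :: real set)"
    then obtain k :: int where "real_of_int b / of_int A = of_int k"
      by (auto elim: Ints_cases)
    then have "real_of_int b = of_int (A * k)"
      using assms(2) by (simp add: field_simps)
    then have "b = A * k"
      by (simp only: of_int_eq_iff)
    then show "A dvd b"
      by simp
  qed (use assms(2) in auto)
  with B_kink[of "of_int b" "1 / of_int A"] add.prems
  have "((\<lambda>h. (B (of_int b * (1 / of_int A + h)) + B (of_int b * (1 / of_int A - h))
      - 2 * B (of_int b * (1 / of_int A))) / h) \<longlongrightarrow> - of_int (if A dvd b then b else 0)) (at_right 0)"
    by auto
  from tendsto_add[OF this add.IH] add.prems show ?case
    by (simp add: add_divide_distrib diff_divide_distrib algebra_simps)
qed simp

text \<open>The constant \<open>c\<close> drops out of second differences, so both sums have the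
  same total kink at every 1 / A. Take A largest in the difference: its own side has weight at least
  A since all indices are positive, the other side weight 0.\<close>

lemma sum_B_eqD:
  fixes M N :: "int multiset" and c :: real
  assumes "\<forall>a\<in>#M. 0 < a" "\<forall>b\<in>#N. 0 < b"
    and eq: "\<And>x. (\<Sum>a\<in>#M. B (of_int a * x)) - (\<Sum>b\<in>#N. B (of_int b * x)) = c"
  shows "M = N"
proof -
  define w where "w A K = (\<Sum>b\<in>#K. if A dvd b then b else 0)" for A :: int and K
  have w: "w A M = w A N" if "A > 0" for A
  proof -
    define F where "F x = (\<Sum>b\<in>#M. B (of_int b * x))" for x :: real
    define G where "G x = (\<Sum>b\<in>#N. B (of_int b * x))" for x :: real
    have F: "F = (\<lambda>x. G x + c)"
      using eq by (auto simp: F_def G_def fun_eq_iff algebra_simps)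
    then have FG: "F (x + h) + F (x - h) - 2 * F x = G (x + h) + G (x - h) - 2 * G x" for x h
      by simp
    have "((\<lambda>h. (G (1 / of_int A + h) + G (1 / of_int A - h) - 2 * G (1 / of_int A)) / h)
        \<longlongrightarrow> - of_int (w A M)) (at_right 0)"
      using sum_B_kink[OF assms(1) that] unfolding w_def F_def[symmetric] FG .
    moreover have "((\<lambda>h. (G (1 / of_int A + h) + G (1 / of_int A - h) - 2 * G (1 / of_int A)) / h)
        \<longlongrightarrow> - of_int (w A N)) (at_right 0)"
      using sum_B_kink[OF assms(2) that] unfolding w_def G_def[symmetric] .
    ultimately show ?thesis
      using tendsto_unique[OF trivial_limit_at_right_real] by fastforce
  qed
  have contra: False
    if pos: "\<forall>a\<in>#K. 0 < a" "\<forall>b\<in>#L. 0 < b" and eq: "\<And>A. A > 0 \<Longrightarrow> w A K = w A L"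
      and A: "A \<in># K - L" "\<forall>b\<in>#L - K. b < A" for K L :: "int multiset" and A
  proof -
    have "A > 0"
      using pos A(1) by (meson in_diffD)
    have split: "w A K = w A (K \<inter># L) + w A (K - L)" for K L
      unfolding w_def
      by (subst (1) multiset_inter_plus_diff[of K L, symmetric]) (simp only: image_mset_union sum_mset.union)
    have "w A (K - L) = w A (L - K)"
      using eq[OF \<open>A > 0\<close>] split[of K L] split[of L K] by (simp add: subset_mset.inf_commute)
    \<comment> \<open>The indices here lie strictly between 0 and A, so none is a multiple of
      A.\<close>
    also have "w A (L - K) = (\<Sum>b\<in>#L - K. 0)"
      unfolding w_def
    proof (intro arg_cong[of _ _ sum_mset] image_mset_cong)
      fix b
      assume "b \<in># L - K"
      then have "0 < b" "b < A"
        using pos(2) A(2) by (auto dest: in_diffD)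
      then show "(if A dvd b then b else 0) = 0"
        using zdvd_not_zless by auto
    qed
    finally have 0: "w A (K - L) = 0"
      by simp
    obtain R where R: "K - L = add_mset A R"
      using A(1) by (meson multi_member_split)
    have "b > 0" if "b \<in># R" for b
      using pos(1) that R by (metis in_diffD union_single_eq_member add_mset_commute insert_DiffM)
    then have "w A R \<ge> 0"
      unfolding w_def by (induction R) (auto intro: add_nonneg_nonneg less_imp_le)
    then show False
      using 0 \<open>A > 0\<close> by (simp add: R w_def)
  qed
  show ?thesis
    by (rule multiset_eq_by_max_difference; rule contra) (use assms w in \<open>auto\<close>)
qed

section \<open>Theta quotients\<close>

text \<open>Extends identities obtained by dividing, valid only off isolated zeros, to those zeros
  themselves.\<close>

lemma continuous_eq_if_eventually_eq:
  fixes f g :: "complex \<Rightarrow> complex"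
  assumes "f holomorphic_on UNIV" "g holomorphic_on UNIV" "\<forall>\<^sub>F z in at x. f z = g z"
  shows "f x = g x"
proof -
  have "isCont f x" "isCont g x"
    using assms(1,2) by (auto dest!: holomorphic_on_imp_continuous_on
        simp: continuous_on_eq_continuous_at)
  then have "f \<midarrow>x\<rightarrow> f x" "g \<midarrow>x\<rightarrow> g x"
    by (auto simp: isCont_def)
  moreover have "f \<midarrow>x\<rightarrow> g x"
    using \<open>g \<midarrow>x\<rightarrow> g x\<close> assms(3) by (simp add: tendsto_cong)
  ultimately show ?thesis
    using LIM_unique by blast
qed

text \<open>Multisets provide the cancellation of common factors through intersection and
  difference.\<close>

definition theta_prod :: "complex \<Rightarrow> int multiset \<Rightarrow> complex \<Rightarrow> complex" where
  "theta_prod \<tau> M z = (\<Prod>a\<in>#M. theta_mult a \<tau> z)"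

lemma theta_prod_union: "theta_prod \<tau> (M + N) z = theta_prod \<tau> M z * theta_prod \<tau> N z"
  by (simp add: theta_prod_def)

lemma theta_prod_holomorphic [holomorphic_intros]:
  assumes "\<tau> \<in> upper_half"
  shows "theta_prod \<tau> M holomorphic_on S"
proof (induction M)
  case (add a M)
  have "(\<lambda>z. theta_mult a \<tau> z * theta_prod \<tau> M z) holomorphic_on S"
    unfolding theta_mult_def by (intro holomorphic_intros assms add)
  then show ?case
    by (simp add: theta_prod_def[abs_def])
qed (simp add: theta_prod_def[abs_def])

lemma eventually_theta_prod_nonzero:
  assumes "\<tau> \<in> upper_half" "0 \<notin># M"
  shows "\<forall>\<^sub>F z in at x. theta_prod \<tau> M z \<noteq> 0"
  using assms(2)
proof (induction M)
  case (add a M)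
  then have "\<forall>\<^sub>F z in at x. theta_mult a \<tau> z \<noteq> 0" "\<forall>\<^sub>F z in at x. theta_prod \<tau> M z \<noteq> 0"
    using assms(1) by (auto intro: eventually_theta_nonzero)
  then show ?case
    by eventually_elim (simp add: theta_prod_def)
qed (simp add: theta_prod_def)

text \<open>After cancelling common factors, the largest index \<open>A\<close> occurs on one side only. At
  \<open>z = 1 / A\<close> that side vanishes, whereas the other side is a product of values of \<open>theta\<close> in the
  open unit interval.\<close>

lemma theta_prod_eqD:
  assumes pos: "\<forall>a\<in>#M. 0 < a" "\<forall>b\<in>#N. 0 < b" and cd: "c \<noteq> 0" "d \<noteq> 0"
    and eq: "\<And>z. c * theta_prod tau0 M z = d * theta_prod tau0 N z"
  shows "M = N"
proof -
  have contra: False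
    if pos: "\<forall>a\<in>#K. 0 < a" "\<forall>b\<in>#L. 0 < b" and cd: "c \<noteq> 0" "d \<noteq> 0"
      and eq: "\<And>z. c * theta_prod tau0 K z = d * theta_prod tau0 L z"
      and A: "A \<in># K - L" "\<forall>b\<in>#L - K. b < A" for K L :: "int multiset" and A c d
  proof -
    have "A > 0"
      using pos A(1) by (meson in_diffD)
    have "0 \<notin># K \<inter># L"
      using pos by auto
    then have "\<forall>\<^sub>F z in at x. theta_prod tau0 (K \<inter># L) z \<noteq> 0" for x
      by (intro eventually_theta_prod_nonzero tau0_upper_half)
    \<comment> \<open>The common factor is cancelled off its isolated zeros; continuity then
      restores the identity at every point, in particular at 1 / A.\<close>
    then have "\<forall>\<^sub>F z in at x. c * theta_prod tau0 (K - L) z = d * theta_prod tau0 (L - K) z" for x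
    proof (rule eventually_mono)
      fix z
      assume "theta_prod tau0 (K \<inter># L) z \<noteq> 0"
      moreover have "theta_prod tau0 K z = theta_prod tau0 (K \<inter># L) z * theta_prod tau0 (K - L) z"
        by (simp only: multiset_inter_plus_diff flip: theta_prod_union)
      moreover have "theta_prod tau0 L z = theta_prod tau0 (K \<inter># L) z * theta_prod tau0 (L - K) z"
        by (simp only: multiset_inter_plus_diff subset_mset.inf_commute[of K L] flip: theta_prod_union)
      ultimately show "c * theta_prod tau0 (K - L) z = d * theta_prod tau0 (L - K) z"
        using eq[of z] by simp
    qed
    then have "c * theta_prod tau0 (K - L) z = d * theta_prod tau0 (L - K) z" for z
      by (intro continuous_eq_if_eventually_eq holomorphic_intros tau0_upper_half)
    moreover have "theta_prod tau0 (K - L) (1 / of_int A) = 0"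
    proof -
      have "theta_mult A tau0 (1 / of_int A) = 0"
        using \<open>A > 0\<close> theta_1[OF tau0_upper_half] by (simp add: theta_mult_def)
      then show ?thesis
        unfolding theta_prod_def prod_mset_zero_iff using A(1) by force
    qed
    moreover have "theta_prod tau0 (L - K) (1 / of_int A) \<noteq> 0"
    proof -
      have "theta_mult b tau0 (1 / of_int A) \<noteq> 0" if "b \<in># L - K" for b
      proof -
        have "0 < b" "b < A"
          using that A(2) pos(2) by (auto dest: in_diffD)
        then show ?thesis
          using theta_tau0_nonzero[of "of_int b / of_int A"] by (simp add: theta_mult_def)
      qed
      then show ?thesis
        unfolding theta_prod_def prod_mset_zero_iff by force
    qed
    ultimately show False
      using cd by (metis mult_eq_0_iff)
  qed
  show ?thesis
  proof (rule multiset_eq_by_max_difference)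
    fix A
    assume "A \<in># M - N" "\<forall>b\<in>#N - M. b < A"
    then show False
      using contra[OF pos cd eq] by blast
  next
    fix A
    assume "A \<in># N - M" "\<forall>b\<in>#M - N. b < A"
    then show False
      using contra[OF pos(2,1) cd(2,1) eq[symmetric]] by blast
  qed
qed

section \<open>Theta quotients up to removable singularities\<close>

lemma theta_quotient_eq:
  "theta_quotient n as bs = (\<lambda>\<tau>\<in>upper_half. remove_sings (\<lambda>z.
     eta \<tau> powi n * theta_prod \<tau> (mset as) z / theta_prod \<tau> (mset bs) z))"
  by (simp add: theta_quotient_def theta_prod_def flip: prod_mset_prod_list)

lemma isolated_singularity_theta_quotient:
  assumes "\<tau> \<in> upper_half"
  shows "isolated_singularity_at (\<lambda>z. c * theta_prod \<tau> M z / theta_prod \<tau> N z) x"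
proof -
  have "(\<lambda>z. c * theta_prod \<tau> M z) analytic_on {x}" "theta_prod \<tau> N analytic_on {x}"
    by (rule analytic_on_subset[of _ UNIV], simp add: analytic_on_open,
        intro holomorphic_intros assms, simp)+
  then show ?thesis
    by (intro isolated_singularity_at_divide isolated_singularity_at_analytic not_essential_analytic)
qed

text \<open>\<open>remove_sings\<close> depends only on values in punctured neighbourhoods, and
  there it agrees with the raw quotient. So it suffices to multiply fractions; the exponents of eta
  add because eta has no zeros.\<close>

lemma TQ_mult:
  "theta_quotient n as bs \<otimes>\<^bsub>TQ\<^esub> theta_quotient n' as' bs'
    = theta_quotient (n + n') (as @ as') (bs @ bs')"
proof -
  have "remove_sings (\<lambda>z. remove_sings (\<lambda>z. eta \<tau> powi n * theta_prod \<tau> (mset as) z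
        / theta_prod \<tau> (mset bs) z) z
      * remove_sings (\<lambda>z. eta \<tau> powi n' * theta_prod \<tau> (mset as') z
        / theta_prod \<tau> (mset bs') z) z) x
    = remove_sings (\<lambda>z. eta \<tau> powi (n + n') * theta_prod \<tau> (mset as + mset as') z
        / theta_prod \<tau> (mset bs + mset bs') z) x"
    if "\<tau> \<in> upper_half" for \<tau> x
  proof (rule remove_sings_cong[OF _ refl])
    have e: "\<forall>\<^sub>F z in at x. remove_sings (\<lambda>z. c * theta_prod \<tau> M z / theta_prod \<tau> N z) z
        = c * theta_prod \<tau> M z / theta_prod \<tau> N z" for c M N
      by (intro eventually_remove_sings_eq_at isolated_singularity_theta_quotient that)
    show "\<forall>\<^sub>F z in at x. remove_sings (\<lambda>z. eta \<tau> powi n * theta_prod \<tau> (mset as) z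
        / theta_prod \<tau> (mset bs) z) z
      * remove_sings (\<lambda>z. eta \<tau> powi n' * theta_prod \<tau> (mset as') z
        / theta_prod \<tau> (mset bs') z) z
      = eta \<tau> powi (n + n') * theta_prod \<tau> (mset as + mset as') z
        / theta_prod \<tau> (mset bs + mset bs') z"
      using e[of "eta \<tau> powi n" "mset as" "mset bs"] e[of "eta \<tau> powi n'" "mset as'" "mset bs'"]
    proof eventually_elim
      case (elim z)
      then show ?case
        using eta_nonzero[OF that] by (simp add: theta_prod_union power_int_add)
    qed
  qed
  then show ?thesis
    unfolding theta_quotient_eq TQ_def by (auto simp: fun_eq_iff restrict_def)
qed

text \<open>Clears denominators: an equality of normal forms becomes one between entire functions,
  valid at every point and free of conventions about poles.\<close>

lemma theta_quotient_eq_const_iff: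
  assumes "0 \<notin> set as" "0 \<notin> set bs"
  shows "theta_quotient n as bs = (\<lambda>\<tau>\<in>upper_half. \<lambda>z. c)
    \<longleftrightarrow> (\<forall>\<tau>\<in>upper_half. \<forall>z. eta \<tau> powi n * theta_prod \<tau> (mset as) z = c * theta_prod \<tau> (mset bs) z)"
    (is "?L \<longleftrightarrow> ?R")
proof
  assume L: ?L
  show ?R
  proof (intro ballI allI)
    fix \<tau> x
    assume \<tau>: "\<tau> \<in> upper_half"
    let ?q = "\<lambda>z. eta \<tau> powi n * theta_prod \<tau> (mset as) z / theta_prod \<tau> (mset bs) z"
    have "remove_sings ?q = (\<lambda>z. c)"
      using fun_cong[OF L, of \<tau>] \<tau> by (simp add: theta_quotient_eq)
    moreover have "\<forall>\<^sub>F z in at x. remove_sings ?q z = ?q z"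
      by (intro eventually_remove_sings_eq_at isolated_singularity_theta_quotient \<tau>)
    ultimately have "\<forall>\<^sub>F z in at x. ?q z = c"
      by (auto elim: eventually_mono)
    moreover have "\<forall>\<^sub>F z in at x. theta_prod \<tau> (mset bs) z \<noteq> 0"
      using assms by (intro eventually_theta_prod_nonzero \<tau>) auto
    ultimately have "\<forall>\<^sub>F z in at x. eta \<tau> powi n * theta_prod \<tau> (mset as) z = c * theta_prod \<tau> (mset bs) z"
      by eventually_elim (auto simp: field_simps)
    then show "eta \<tau> powi n * theta_prod \<tau> (mset as) x = c * theta_prod \<tau> (mset bs) x"
      by (intro continuous_eq_if_eventually_eq holomorphic_intros \<tau>)
  qed
next
  assume R: ?R
  have "remove_sings (\<lambda>z. eta \<tau> powi n * theta_prod \<tau> (mset as) z / theta_prod \<tau> (mset bs) z) x = c"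
    if \<tau>: "\<tau> \<in> upper_half" for \<tau> x
  proof -
    have "\<forall>\<^sub>F z in at x. theta_prod \<tau> (mset bs) z \<noteq> 0"
      using assms by (intro eventually_theta_prod_nonzero \<tau>) auto
    then have "\<forall>\<^sub>F z in at x. eta \<tau> powi n * theta_prod \<tau> (mset as) z / theta_prod \<tau> (mset bs) z = c"
      by eventually_elim (use R \<tau> in auto)
    then have "remove_sings (\<lambda>z. eta \<tau> powi n * theta_prod \<tau> (mset as) z / theta_prod \<tau> (mset bs) z) x
        = remove_sings (\<lambda>z. c) x"
      by (intro remove_sings_cong) auto
    then show ?thesis
      by simp
  qed
  then show ?L
    by (auto simp: theta_quotient_eq fun_eq_iff restrict_def)
qed

text \<open>By oddness each negative index costs a factor -1. The sign \<open>s\<close> is chosen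
  before \<tau> and z, so it is one constant on the whole domain.\<close>

lemma theta_prod_abs:
  assumes "0 \<notin> set as"
  obtains s :: complex where "s \<in> {1, - 1}"
    and "\<And>\<tau> z. \<tau> \<in> upper_half \<Longrightarrow>
      theta_prod \<tau> (mset as) z = s * theta_prod \<tau> (mset (map abs as)) z"
  using assms
proof (induction as arbitrary: thesis)
  case Nil
  show ?case
    by (rule Nil(1)[of 1]) auto
next
  case (Cons a as)
  obtain s :: complex where s: "s \<in> {1, - 1}" "\<And>\<tau> z. \<tau> \<in> upper_half \<Longrightarrow>
      theta_prod \<tau> (mset as) z = s * theta_prod \<tau> (mset (map abs as)) z"
    using Cons.IH Cons.prems(2) by auto
  define r :: complex where "r = (if a > 0 then 1 else - 1)"
  have "theta_mult a \<tau> z = r * theta_mult \<bar>a\<bar> \<tau> z" if "\<tau> \<in> upper_half" for \<tau> z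
    using theta_minus[OF that, of "of_int a * z"] by (auto simp: theta_mult_def r_def)
  then have "theta_prod \<tau> (mset (a # as)) z = (r * s) * theta_prod \<tau> (mset (map abs (a # as))) z"
    if "\<tau> \<in> upper_half" for \<tau> z
    using s(2)[OF that, of z] that by (simp add: theta_prod_def)
  moreover have "r * s \<in> {1, - 1}"
    using s(1) by (auto simp: r_def)
  ultimately show ?case
    using Cons.prems(1) by blast
qed

lemma formal_ord_abs: "formal_ord n (map abs as) (map abs bs) = formal_ord n as bs"
proof -
  have "B (of_int \<bar>a\<bar> * x) = B (of_int a * x)" for a x
    using B_minus[of "of_int a * x"] by (cases "a \<ge> 0") auto
  then show ?thesis
    by (simp add: formal_ord_def o_def)
qed

text \<open>\<open>B\<close> is even, so all indices may be taken positive. Independence of the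
  kinks then applies, with the eta exponent in the role of the constant.\<close>

lemma formal_ord_eq_0_iff:
  assumes "0 \<notin> set as" "0 \<notin> set bs"
  shows "formal_ord n as bs = (\<lambda>x. 0) \<longleftrightarrow> n = 0 \<and> mset (map abs as) = mset (map abs bs)"
proof
  assume 0: "formal_ord n as bs = (\<lambda>x. 0)"
  have *: "(\<Sum>a\<in>#mset (map abs as). B (of_int a * x)) - (\<Sum>b\<in>#mset (map abs bs). B (of_int b * x))
      = - (of_int n / 24)" for x
    using fun_cong[OF 0, of x] unfolding formal_ord_abs[of n as bs, symmetric]
    by (simp add: formal_ord_def multiset.map_comp o_def algebra_simps flip: sum_mset_sum_list)
  then have M: "mset (map abs as) = mset (map abs bs)"
    by (intro sum_B_eqD[where c = "- (of_int n / 24)"]) (use assms in auto)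
  \<comment> \<open>With equal multisets the two sums cancel at any point, leaving only the eta
    term.\<close>
  have "0 = - (real_of_int n / 24)"
    using *[of 0] unfolding M by (simp only: diff_self)
  with M show "n = 0 \<and> mset (map abs as) = mset (map abs bs)"
    by simp
next
  assume *: "n = 0 \<and> mset (map abs as) = mset (map abs bs)"
  then have "(\<Sum>a\<in>#mset (map abs as). B (of_int a * x)) = (\<Sum>b\<in>#mset (map abs bs). B (of_int b * x))" for x
    by simp
  then show "formal_ord n as bs = (\<lambda>x. 0)"
    using * unfolding formal_ord_abs[of n as bs, symmetric]
    by (simp add: formal_ord_def multiset.map_comp o_def flip: sum_mset_sum_list)
qed

text \<open>The analytic counterpart of \<open>formal_ord_eq_0_iff\<close> with the same right-hand
  side; comparing the two yields the kernel of the order. The forward direction needs only the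
  values at \<open>tau0\<close>.\<close>

lemma theta_quotient_in_signs_iff:
  assumes "0 \<notin> set as" "0 \<notin> set bs"
  shows "theta_quotient n as bs \<in> TQ_signs \<longleftrightarrow> n = 0 \<and> mset (map abs as) = mset (map abs bs)"
proof -
  obtain s where s: "s \<in> {1, - 1}" "\<And>\<tau> z. \<tau> \<in> upper_half \<Longrightarrow>
      theta_prod \<tau> (mset as) z = s * theta_prod \<tau> (mset (map abs as)) z"
    using theta_prod_abs[OF assms(1)] by blast
  obtain t where t: "t \<in> {1, - 1}" "\<And>\<tau> z. \<tau> \<in> upper_half \<Longrightarrow>
      theta_prod \<tau> (mset bs) z = t * theta_prod \<tau> (mset (map abs bs)) z"
    using theta_prod_abs[OF assms(2)] by blast
  note const_iff = theta_quotient_eq_const_iff[OF assms, of n]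
  show ?thesis
  proof
    assume "theta_quotient n as bs \<in> TQ_signs"
    then obtain c where c: "c \<in> {1, - 1}" "theta_quotient n as bs = (\<lambda>\<tau>\<in>upper_half. \<lambda>z. c)"
      by (auto simp: TQ_signs_def)
    have eq: "(eta tau0 powi n * s) * theta_prod tau0 (mset (map abs as)) z
        = (c * t) * theta_prod tau0 (mset (map abs bs)) z" for z
    proof -
      have "eta tau0 powi n * theta_prod tau0 (mset as) z = c * theta_prod tau0 (mset bs) z"
        using c(2) tau0_upper_half unfolding const_iff by blast
      then show ?thesis
        by (simp only: s(2) t(2) tau0_upper_half mult.assoc)
    qed
    have M: "mset (map abs as) = mset (map abs bs)"
    proof (rule theta_prod_eqD[OF _ _ _ _ eq])
      show "eta tau0 powi n * s \<noteq> 0"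
        using s(1) eta_nonzero[OF tau0_upper_half] by auto
      show "c * t \<noteq> 0"
        using c t by auto
    qed (use assms in auto)
    have "0 \<notin># mset (map abs bs)"
      using assms by auto
    \<comment> \<open>Dividing by the common product at a point where it is nonzero leaves a power
      of eta equal to a sign, whose modulus 1 forces the exponent 0.\<close>
    then obtain z where "theta_prod tau0 (mset (map abs bs)) z \<noteq> 0"
      using eventually_happens'[OF at_neq_bot eventually_theta_prod_nonzero[OF tau0_upper_half]]
      by blast
    then have "eta tau0 powi n * s = c * t"
      using eq[of z] unfolding M by simp
    then have "norm (eta tau0 powi n * s) = norm (c * t)"
      by simp
    then have "norm (eta tau0 powi n) = 1"
      using s(1) t(1) c(1) by (auto simp: norm_mult)
    then show "n = 0 \<and> mset (map abs as) = mset (map abs bs)"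
      using M eta_tau0_powi_eq by blast
  next
    assume *: "n = 0 \<and> mset (map abs as) = mset (map abs bs)"
    \<comment> \<open>The ratio of the signs \<open>s\<close> and \<open>t\<close> is their product,
      as \<open>t\<close> is its own inverse.\<close>
    have "theta_quotient n as bs = (\<lambda>\<tau>\<in>upper_half. \<lambda>z. s * t)"
      unfolding const_iff using * s t by auto
    then show "theta_quotient n as bs \<in> TQ_signs"
      using s(1) t(1) by (auto simp: TQ_signs_def)
  qed
qed

lemma theta_quotient_in_signs_iff_ord:
  assumes "0 \<notin> set as" "0 \<notin> set bs"
  shows "theta_quotient n as bs \<in> TQ_signs \<longleftrightarrow> formal_ord n as bs = (\<lambda>x. 0)"
  using assms by (simp add: theta_quotient_in_signs_iff formal_ord_eq_0_iff)

lemma theta_quotient_eq_one: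
  assumes "0 \<notin> set as" "0 \<notin> set bs" "mset as = mset bs"
  shows "theta_quotient 0 as bs = \<one>\<^bsub>TQ\<^esub>"
proof -
  have "\<one>\<^bsub>TQ\<^esub> = (\<lambda>\<tau>\<in>upper_half. \<lambda>z. 1)"
    by (simp add: TQ_def)
  then show ?thesis
    using theta_quotient_eq_const_iff[OF assms(1,2), of 0 1] assms(3) by simp
qed

section \<open>The groups and the order homomorphism\<close>

lemma carrier_TQ: "carrier TQ = {theta_quotient n as bs | n as bs. 0 \<notin> set as \<and> 0 \<notin> set bs}"
  by (simp add: TQ_def)

lemma TQ_carrierE:
  assumes "f \<in> carrier TQ"
  obtains n as bs where "0 \<notin> set as" "0 \<notin> set bs" "f = theta_quotient n as bs"
  using assms by (auto simp: carrier_TQ)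

lemma TQ_one: "\<one>\<^bsub>TQ\<^esub> = theta_quotient 0 [] []"
  by (rule theta_quotient_eq_one[symmetric]) auto

lemma TQ_inverse:
  assumes "0 \<notin> set as" "0 \<notin> set bs"
  shows "theta_quotient (- n) bs as \<otimes>\<^bsub>TQ\<^esub> theta_quotient n as bs = \<one>\<^bsub>TQ\<^esub>"
proof -
  have "theta_quotient 0 (bs @ as) (as @ bs) = \<one>\<^bsub>TQ\<^esub>"
    using assms by (intro theta_quotient_eq_one) auto
  then show ?thesis
    by (simp add: TQ_mult)
qed

interpretation TQ: group TQ
proof (rule groupI)
  fix f g
  assume "f \<in> carrier TQ" "g \<in> carrier TQ"
  then obtain n as bs n' as' bs' where
    "0 \<notin> set as" "0 \<notin> set bs" "f = theta_quotient n as bs"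
    "0 \<notin> set as'" "0 \<notin> set bs'" "g = theta_quotient n' as' bs'"
    by (metis TQ_carrierE)
  moreover from this have "0 \<notin> set (as @ as')" "0 \<notin> set (bs @ bs')"
    by auto
  ultimately show "f \<otimes>\<^bsub>TQ\<^esub> g \<in> carrier TQ"
    unfolding carrier_TQ by (auto simp only: TQ_mult)
next
  show "\<one>\<^bsub>TQ\<^esub> \<in> carrier TQ"
    unfolding TQ_one carrier_TQ by force
next
  fix f g h
  assume "f \<in> carrier TQ" "g \<in> carrier TQ" "h \<in> carrier TQ"
  then show "f \<otimes>\<^bsub>TQ\<^esub> g \<otimes>\<^bsub>TQ\<^esub> h = f \<otimes>\<^bsub>TQ\<^esub> (g \<otimes>\<^bsub>TQ\<^esub> h)"
    by (elim TQ_carrierE) (simp add: TQ_mult add.assoc)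
next
  fix f
  assume "f \<in> carrier TQ"
  then show "\<one>\<^bsub>TQ\<^esub> \<otimes>\<^bsub>TQ\<^esub> f = f"
    by (elim TQ_carrierE) (simp add: TQ_one TQ_mult)
next
  fix f
  assume "f \<in> carrier TQ"
  then obtain n as bs where "0 \<notin> set as" "0 \<notin> set bs" "f = theta_quotient n as bs"
    by (rule TQ_carrierE)
  then show "\<exists>g\<in>carrier TQ. g \<otimes>\<^bsub>TQ\<^esub> f = \<one>\<^bsub>TQ\<^esub>"
    by (intro bexI[of _ "theta_quotient (- n) bs as"]) (auto simp: TQ_inverse carrier_TQ)
qed

lemma TQ_inv:
  assumes "0 \<notin> set as" "0 \<notin> set bs"
  shows "inv\<^bsub>TQ\<^esub> (theta_quotient n as bs) = theta_quotient (- n) bs as"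
  using assms TQ_inverse by (intro TQ.inv_equality) (auto simp: carrier_TQ)

text \<open>Turns a comparison of two quotients into a statement about one, so that the criteria for
  a single presentation settle both well-definedness and injectivity.\<close>

lemma TQ_divide:
  assumes "0 \<notin> set as" "0 \<notin> set bs" "0 \<notin> set as'" "0 \<notin> set bs'"
  shows "theta_quotient (n - n') (as @ bs') (bs @ as') = \<one>\<^bsub>TQ\<^esub>
    \<longleftrightarrow> theta_quotient n as bs = theta_quotient n' as' bs'"
proof -
  have "theta_quotient (n - n') (as @ bs') (bs @ as')
      = theta_quotient n as bs \<otimes>\<^bsub>TQ\<^esub> inv\<^bsub>TQ\<^esub> (theta_quotient n' as' bs')"
    using assms by (simp add: TQ_inv TQ_mult)
  moreover have "theta_quotient n as bs \<in> carrier TQ" "theta_quotient n' as' bs' \<in> carrier TQ"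
    using assms by (auto simp: carrier_TQ)
  ultimately show ?thesis
    by (metis TQ.inv_closed TQ.inv_equality TQ.inv_inv TQ.r_inv)
qed

lemma formal_ord_append:
  "formal_ord (n + n') (as @ as') (bs @ bs') = (\<lambda>x. formal_ord n as bs x + formal_ord n' as' bs' x)"
  by (simp add: formal_ord_def add_divide_distrib algebra_simps)

lemma formal_ord_uminus: "formal_ord (- n) bs as = (\<lambda>x. - formal_ord n as bs x)"
  by (simp add: formal_ord_def)

lemma formal_ord_divide:
  "formal_ord (n - n') (as @ bs') (bs @ as') = (\<lambda>x. formal_ord n as bs x - formal_ord n' as' bs' x)"
  using formal_ord_append[of n "- n'" as bs' bs as'] by (simp add: formal_ord_uminus)

lemma TQ_one_in_signs: "\<one>\<^bsub>TQ\<^esub> \<in> TQ_signs"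
  by (simp add: TQ_def TQ_signs_def)

text \<open>Makes the order well defined: the ratio of two presentations is 1, hence has formal
  order 0, and formal orders subtract.\<close>

lemma formal_ord_cong:
  assumes "0 \<notin> set as" "0 \<notin> set bs" "0 \<notin> set as'" "0 \<notin> set bs'"
    and "theta_quotient n as bs = theta_quotient n' as' bs'"
  shows "formal_ord n as bs = formal_ord n' as' bs'"
proof -
  have "theta_quotient (n - n') (as @ bs') (bs @ as') \<in> TQ_signs"
    using TQ_divide[OF assms(1-4), of n n'] assms(5) TQ_one_in_signs by metis
  then have "formal_ord (n - n') (as @ bs') (bs @ as') = (\<lambda>x. 0)"
    using assms(1-4) by (subst (asm) theta_quotient_in_signs_iff_ord) auto
  then show ?thesis
    unfolding formal_ord_divide by (auto simp: fun_eq_iff)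
qed

lemma ord_infinity_theta_quotient:
  assumes "0 \<notin> set as" "0 \<notin> set bs"
  shows "ord_infinity (theta_quotient n as bs) = formal_ord n as bs"
  unfolding ord_infinity_def
proof (rule the_equality)
  fix g
  assume "\<exists>n' as' bs'. 0 \<notin> set as' \<and> 0 \<notin> set bs' \<and>
    theta_quotient n as bs = theta_quotient n' as' bs' \<and> g = formal_ord n' as' bs'"
  then show "g = formal_ord n as bs"
    using formal_ord_cong[OF assms] by metis
qed (use assms in blast)

section \<open>The additive group BF as the set of formal orders\<close>

interpretation real_functions: group real_functions
proof (rule groupI)
  fix f
  assume "f \<in> carrier real_functions"
  show "\<exists>g\<in>carrier real_functions. g \<otimes>\<^bsub>real_functions\<^esub> f = \<one>\<^bsub>real_functions\<^esub>"
    by (rule bexI[of _ "\<lambda>x. - f x"]) (auto simp: real_functions_def)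
qed (auto simp: real_functions_def add.assoc)

lemma real_functions_inv: "inv\<^bsub>real_functions\<^esub> f = (\<lambda>x. - f x)"
  by (rule real_functions.inv_equality) (auto simp: real_functions_def)

lemma real_functions_carrier: "carrier real_functions = UNIV"
  by (simp add: real_functions_def)

lemma group_BF: "group BF"
  unfolding BF_def
  by (intro real_functions.subgroup_imp_group real_functions.generate_is_subgroup)
    (simp add: real_functions_def)

lemma BF_simps:
  "f \<otimes>\<^bsub>BF\<^esub> g = (\<lambda>x. f x + g x)" "\<one>\<^bsub>BF\<^esub> = (\<lambda>x. 0)"
  by (simp_all add: BF_def real_functions_def)

lemma BF_generators:
  "a > 0 \<Longrightarrow> (\<lambda>x. B (of_int a * x)) \<in> carrier BF" "(\<lambda>x. 1 / 24) \<in> carrier BF"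
  unfolding BF_def by (auto intro!: generate.incl)

lemma BF_add: "f \<in> carrier BF \<Longrightarrow> g \<in> carrier BF \<Longrightarrow> (\<lambda>x. f x + g x) \<in> carrier BF"
  using group.is_monoid[OF group_BF] monoid.m_closed[of BF f g] by (simp add: BF_simps)

lemma BF_uminus:
  assumes "f \<in> carrier BF"
  shows "(\<lambda>x. - f x) \<in> carrier BF"
proof -
  have "inv\<^bsub>real_functions\<^esub> f \<in> carrier BF"
    using assms unfolding BF_def
    by (auto intro!: real_functions.generate_m_inv_closed simp: real_functions_carrier)
  then show ?thesis
    by (simp add: real_functions_inv)
qed

lemma BF_zero: "(\<lambda>x. 0) \<in> carrier BF"
  using monoid.one_closed[OF group.is_monoid[OF group_BF]] by (simp add: BF_simps)

lemma formal_ord_in_BF: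
  assumes "0 \<notin> set as" "0 \<notin> set bs"
  shows "formal_ord n as bs \<in> carrier BF"
proof -
  have sum: "(\<lambda>x. \<Sum>a\<leftarrow>as. B (of_int a * x)) \<in> carrier BF" if "\<forall>a\<in>set as. a > 0" for as
    using that by (induction as) (auto intro: BF_zero BF_add BF_generators)
  have nat: "(\<lambda>x. of_nat k / 24) \<in> carrier BF" for k
  proof (induction k)
    case (Suc k)
    from BF_add[OF BF_generators(2) this] show ?case
      by (simp add: add_divide_distrib)
  qed (simp add: BF_zero)
  have int: "(\<lambda>x. of_int n / 24) \<in> carrier BF"
    using nat[of "nat n"] BF_uminus[OF nat[of "nat (- n)"]] by (cases "n \<ge> 0") auto
  have "(\<lambda>x. (\<Sum>a\<leftarrow>map abs as. B (of_int a * x)) + - (\<Sum>b\<leftarrow>map abs bs. B (of_int b * x)) + of_int n / 24)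
      \<in> carrier BF"
    by (intro BF_add BF_uminus sum int) (use assms in auto)
  then have "formal_ord n (map abs as) (map abs bs) \<in> carrier BF"
    by (simp add: formal_ord_def)
  then show ?thesis
    by (simp only: formal_ord_abs)
qed

text \<open>Formal orders include the generators and their negatives, and concatenating the lists
  adds them, so they exhaust the span. This gives surjectivity.\<close>

lemma BF_formal_ordE:
  assumes "f \<in> carrier BF"
  obtains n as bs where "0 \<notin> set as" "0 \<notin> set bs" "f = formal_ord n as bs"
proof -
  have gen: "f \<in> generate real_functions ({(\<lambda>x. B (of_int a * x)) | a :: int. a > 0} \<union> {(\<lambda>x. 1 / 24)})"
    using assms by (simp add: BF_def)
  have "\<exists>n as bs. 0 \<notin> set as \<and> 0 \<notin> set bs \<and> f = formal_ord n as bs"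
    using gen
  proof (induction rule: generate.induct)
    case one
    show ?case
      by (rule exI[of _ 0], rule exI[of _ "[]"], rule exI[of _ "[]"])
        (simp add: formal_ord_def real_functions_def)
  next
    case (incl h)
    then consider a where "a > 0" "h = (\<lambda>x. B (of_int a * x))" | "h = (\<lambda>x. 1 / 24)"
      by auto
    then show ?case
    proof cases
      case (1 a)
      then show ?thesis
        by (intro exI[of _ 0] exI[of _ "[a]"] exI[of _ "[]"]) (simp add: formal_ord_def)
    next
      case 2
      then show ?thesis
        by (intro exI[of _ 1] exI[of _ "[]"]) (simp add: formal_ord_def)
    qed
  next
    case (inv h)
    then consider a where "a > 0" "h = (\<lambda>x. B (of_int a * x))" | "h = (\<lambda>x. 1 / 24)"
      by auto
    then show ?case
    proof cases
      case (1 a)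
      then show ?thesis
        by (intro exI[of _ 0] exI[of _ "[]"] exI[of _ "[a]"])
          (simp add: formal_ord_def real_functions_inv)
    next
      case 2
      then show ?thesis
        by (intro exI[of _ "- 1"] exI[of _ "[]"]) (simp add: formal_ord_def real_functions_inv)
    qed
  next
    case (eng f g)
    then obtain n as bs n' as' bs' where *:
      "0 \<notin> set as" "0 \<notin> set bs" "f = formal_ord n as bs"
      "0 \<notin> set as'" "0 \<notin> set bs'" "g = formal_ord n' as' bs'"
      by blast
    then have "f \<otimes>\<^bsub>real_functions\<^esub> g = formal_ord (n + n') (as @ as') (bs @ bs')"
      unfolding formal_ord_append by (simp add: real_functions_def)
    then show ?case
      using * by (metis Un_iff set_append)
  qed
  then show ?thesis
    using that by blast
qed

section \<open>The order homomorphism, its kernel and the positive subgroup\<close>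

lemma ord_infinity_hom: "ord_infinity \<in> hom TQ BF"
proof (rule homI)
  fix f
  assume "f \<in> carrier TQ"
  then show "ord_infinity f \<in> carrier BF"
    by (elim TQ_carrierE) (simp add: ord_infinity_theta_quotient formal_ord_in_BF)
next
  fix f g
  assume "f \<in> carrier TQ" "g \<in> carrier TQ"
  then show "ord_infinity (f \<otimes>\<^bsub>TQ\<^esub> g) = ord_infinity f \<otimes>\<^bsub>BF\<^esub> ord_infinity g"
    by (elim TQ_carrierE)
      (simp add: TQ_mult ord_infinity_theta_quotient BF_simps formal_ord_append)
qed

interpretation ord: group_hom TQ BF ord_infinity
  using group_BF ord_infinity_hom TQ.is_group by (simp add: group_hom_def group_hom_axioms_def)

lemma ord_infinity_image: "ord_infinity ` carrier TQ = carrier BF"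
proof
  show "carrier BF \<subseteq> ord_infinity ` carrier TQ"
  proof
    fix f
    assume "f \<in> carrier BF"
    then obtain n as bs where "0 \<notin> set as" "0 \<notin> set bs" "f = formal_ord n as bs"
      by (rule BF_formal_ordE)
    then show "f \<in> ord_infinity ` carrier TQ"
      by (intro image_eqI[of _ _ "theta_quotient n as bs"])
        (auto simp: ord_infinity_theta_quotient carrier_TQ)
  qed
qed (use ord_infinity_hom in \<open>auto simp: hom_def\<close>)

lemma TQ_signs_subset: "TQ_signs \<subseteq> carrier TQ"
proof -
  have "theta_quotient 0 [- 1] [1] = (\<lambda>\<tau>\<in>upper_half. \<lambda>z. - 1)"
    by (subst theta_quotient_eq_const_iff) (auto simp: theta_prod_def theta_mult_def theta_minus)
  then have "(\<lambda>\<tau>\<in>upper_half. \<lambda>z. - 1) \<in> carrier TQ"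
    unfolding carrier_TQ by (smt (verit, best) empty_iff empty_set list.simps(15) mem_Collect_eq
        neg_equal_0_iff_equal singletonD zero_neq_one)
  moreover have "(\<lambda>\<tau>\<in>upper_half. \<lambda>z. 1) \<in> carrier TQ"
    using TQ.one_closed by (simp add: TQ_def)
  ultimately show ?thesis
    by (simp add: TQ_signs_def)
qed

lemma kernel_ord_infinity: "kernel TQ BF ord_infinity = TQ_signs"
proof -
  have "ord_infinity f = (\<lambda>x. 0) \<longleftrightarrow> f \<in> TQ_signs" if "f \<in> carrier TQ" for f
    using that
    by (elim TQ_carrierE) (simp add: ord_infinity_theta_quotient theta_quotient_in_signs_iff_ord)
  then show ?thesis
    using TQ_signs_subset by (auto simp: kernel_def BF_simps)
qed

lemma subgroup_TQ_pos: "subgroup TQ_pos TQ"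
proof (rule TQ.subgroupI)
  show "TQ_pos \<subseteq> carrier TQ"
    unfolding TQ_pos_def carrier_TQ by fastforce
  show "TQ_pos \<noteq> {}"
    unfolding TQ_pos_def by (auto intro!: exI[of _ "[]"])
next
  fix f
  assume "f \<in> TQ_pos"
  then obtain n as bs where *: "\<forall>a\<in>set as. 0 < a" "\<forall>b\<in>set bs. 0 < b" "f = theta_quotient n as bs"
    by (auto simp: TQ_pos_def)
  then have "inv\<^bsub>TQ\<^esub> f = theta_quotient (- n) bs as"
    by (simp only:) (intro TQ_inv, auto)
  then show "inv\<^bsub>TQ\<^esub> f \<in> TQ_pos"
    using * by (auto simp: TQ_pos_def)
next
  fix f g
  assume "f \<in> TQ_pos" "g \<in> TQ_pos"
  then obtain n as bs n' as' bs' where *: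
    "\<forall>a\<in>set as. 0 < a" "\<forall>b\<in>set bs. 0 < b" "f = theta_quotient n as bs"
    "\<forall>a\<in>set as'. 0 < a" "\<forall>b\<in>set bs'. 0 < b" "g = theta_quotient n' as' bs'"
    by (auto simp: TQ_pos_def)
  then have "f \<otimes>\<^bsub>TQ\<^esub> g = theta_quotient (n + n') (as @ as') (bs @ bs')"
    by (simp add: TQ_mult)
  moreover have "\<forall>a\<in>set (as @ as'). 0 < a" "\<forall>b\<in>set (bs @ bs'). 0 < b"
    using * by auto
  ultimately show "f \<otimes>\<^bsub>TQ\<^esub> g \<in> TQ_pos"
    unfolding TQ_pos_def by blast
qed

text \<open>Equal orders determine the indices of a ratio up to absolute value. For positive indices
  this is equality on the nose, so the ratio is 1 and not merely a sign; replacing indices by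
  absolute values preserves the order and gives surjectivity.\<close>

lemma ord_infinity_iso_TQ_pos: "ord_infinity \<in> iso (TQ\<lparr>carrier := TQ_pos\<rparr>) BF"
proof -
  have sub: "TQ_pos \<subseteq> carrier TQ"
    using subgroup_TQ_pos by (rule subgroup.subset)
  have "inj_on ord_infinity TQ_pos"
  proof (rule inj_onI)
    fix f g
    assume "f \<in> TQ_pos" "g \<in> TQ_pos" and eq: "ord_infinity f = ord_infinity g"
    then obtain n as bs n' as' bs' where f:
      "\<forall>a\<in>set as. 0 < a" "\<forall>b\<in>set bs. 0 < b" "f = theta_quotient n as bs"
      and g: "\<forall>a\<in>set as'. 0 < a" "\<forall>b\<in>set bs'. 0 < b" "g = theta_quotient n' as' bs'"
      by (auto simp: TQ_pos_def)
    have nz: "0 \<notin> set as" "0 \<notin> set bs" "0 \<notin> set as'" "0 \<notin> set bs'"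
      using f g by auto
    have "formal_ord (n - n') (as @ bs') (bs @ as') = (\<lambda>x. 0)"
      using eq f(3) g(3) nz unfolding formal_ord_divide by (simp add: ord_infinity_theta_quotient)
    then have "n - n' = 0" and M: "mset (map abs (as @ bs')) = mset (map abs (bs @ as'))"
      using nz by (subst (asm) formal_ord_eq_0_iff; simp)+
    moreover have "map abs (as @ bs') = as @ bs'" "map abs (bs @ as') = bs @ as'"
      using f g by (auto intro!: map_idI)
    ultimately have "theta_quotient (n - n') (as @ bs') (bs @ as') = \<one>\<^bsub>TQ\<^esub>"
      using nz by (simp only:) (intro theta_quotient_eq_one, auto)
    then show "f = g"
      using TQ_divide[OF nz] f(3) g(3) by simp
  qed
  moreover have "carrier BF \<subseteq> ord_infinity ` TQ_pos"
  proof
    fix f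
    assume "f \<in> carrier BF"
    then obtain n as bs where *: "0 \<notin> set as" "0 \<notin> set bs" "f = formal_ord n as bs"
      by (rule BF_formal_ordE)
    then have "f = ord_infinity (theta_quotient n (map abs as) (map abs bs))"
      by (subst ord_infinity_theta_quotient) (auto simp: formal_ord_abs)
    moreover have "\<forall>a\<in>set (map abs as). 0 < a" "\<forall>b\<in>set (map abs bs). 0 < b"
      using * by auto
    then have "theta_quotient n (map abs as) (map abs bs) \<in> TQ_pos"
      unfolding TQ_pos_def by blast
    ultimately show "f \<in> ord_infinity ` TQ_pos"
      by blast
  qed
  moreover have "ord_infinity ` TQ_pos \<subseteq> carrier BF"
    using sub ord_infinity_image by blast
  moreover have "ord_infinity \<in> hom (TQ\<lparr>carrier := TQ_pos\<rparr>) BF"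
    by (rule homI) (use sub in \<open>auto simp: subset_iff\<close>)
  ultimately show ?thesis
    by (auto simp: iso_def bij_betw_def)
qed

text \<open>The constant -1 is a theta quotient of order 0, so injectivity holds only up to sign.
  The isomorphism is therefore given in two forms: on the quotient by the signs, via the first
  isomorphism theorem, and on the subgroup with positive indices.\<close>

theorem theorem3p7:
  shows "group TQ \<and> group BF \<and>
    (\<forall>n as bs. 0 \<notin> set as \<longrightarrow> 0 \<notin> set bs \<longrightarrow>
       ord_infinity (theta_quotient n as bs) = formal_ord n as bs) \<and>
    ord_infinity \<in> hom TQ BF \<and>
    ord_infinity ` carrier TQ = carrier BF \<and>
    kernel TQ BF ord_infinity = TQ_signs \<and>
    (\<lambda>C. the_elem (ord_infinity ` C)) \<in> iso (TQ Mod TQ_signs) BF \<and>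
    subgroup TQ_pos TQ \<and>
    ord_infinity \<in> iso (TQ\<lparr>carrier := TQ_pos\<rparr>) BF"
  using TQ.is_group group_BF ord_infinity_hom ord_infinity_image kernel_ord_infinity
    ord.FactGroup_iso_set[OF ord_infinity_image, unfolded kernel_ord_infinity]
    subgroup_TQ_pos ord_infinity_iso_TQ_pos
  by (simp add: ord_infinity_theta_quotient)

end
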